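(* If $r$ is a positive integer, then the real number $e^r$ is irrational.
   Context: The function $e^x$ is the usual real exponential function, defined by its Taylor series $e^x = \sum_{k=0}^\infty \frac{x^k}{k!}$. *)

theory Defs
  imports Complex_Main
begin

end

(* Hermite's method. For a polynomial P put F = P - P' + P'' - ..., so that
   exp * F has derivative exp * P. With P = x^n (x - r)^n, every derivative of P at 0 and at r
   is a multiple of n!, so if e^r = p / q then (p F(r) - q F(0)) / n! is an integer. By the mean
   value theorem it equals q r e^t P(t) / n! for some 0 < t < r, which is nonzero and tends
   to 0 as n grows. *)

theory Submission imports Defs "HOL-Computational_Algebra.Polynomial" begin

lemma poly_in_Ints:
  fixes p :: "'a::comm_ring_1 poly"
  assumes "\<And>i. coeff p i \<in> \<int>" and "x \<in> \<int>"
  shows "poly p x \<in> \<int>"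
  unfolding poly_altdef using assms by (intro Ints_sum Ints_mult Ints_power)

text \<open>The product rule splits the derivative of (X - a)^n s into n (X - a)^(n-1) s and (X -
  a)^n s'. In the first part the factor n reduces n! to (n-1)!; the second keeps n!. Both have the
  original shape with one derivative fewer to take, so the induction on \<open>k\<close> lets
  \<open>n\<close> and \<open>s\<close> vary.\<close>

lemma poly_higher_pderiv_div_fact_in_Ints:
  fixes s :: "'a::field_char_0 poly"
  assumes "\<And>i. coeff s i \<in> \<int>" and "a \<in> \<int>"
  shows "poly ((pderiv ^^ k) ([:-a, 1:] ^ n * s)) a / fact n \<in> \<int>"
  using assms(1)
proof (induction k arbitrary: n s)
  case 0
  then show ?case
    using poly_in_Ints[OF _ assms(2), of s] by (cases n) auto
next
  case (Suc k)
  have s': "coeff (pderiv s) i \<in> \<int>" for i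
    using Suc.prems by (simp add: coeff_pderiv del: of_nat_Suc)
  show ?case
  proof (cases n)
    case 0
    then show ?thesis
      using Suc.IH[of "pderiv s" 0] s' by (simp add: funpow_Suc_right del: funpow.simps(2))
  next
    case (Suc m)
    have "pderiv ([:-a, 1:] ^ n * s) =
        smult (of_nat n) ([:-a, 1:] ^ m * s) + [:-a, 1:] ^ n * pderiv s"
      unfolding Suc pderiv_mult pderiv_power_Suc
      by (simp add: pderiv_pCons algebra_simps del: of_nat_Suc)
    then have "poly ((pderiv ^^ Suc k) ([:-a, 1:] ^ n * s)) a / fact n =
        of_nat n * poly ((pderiv ^^ k) ([:-a, 1:] ^ m * s)) a / fact n
        + poly ((pderiv ^^ k) ([:-a, 1:] ^ n * pderiv s)) a / fact n"
      by (simp add: funpow_Suc_right higher_pderiv_add higher_pderiv_smult add_divide_distrib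
          del: funpow.simps(2))
    also have "of_nat n * poly ((pderiv ^^ k) ([:-a, 1:] ^ m * s)) a / fact n =
        poly ((pderiv ^^ k) ([:-a, 1:] ^ m * s)) a / fact m"
      unfolding Suc by (simp add: divide_simps del: of_nat_Suc)
    finally show ?thesis
      using Suc.IH[OF Suc.prems, of m] Suc.IH[OF s', of n] by simp
  qed
qed

text \<open>This is (1 + D)^(-1) p for D = \<open>pderiv\<close>; the cut-off loses nothing, since
  derivatives beyond the degree vanish.\<close>

definition alternating_pderivs :: "'a::idom poly \<Rightarrow> 'a poly" where
  "alternating_pderivs p = (\<Sum>k\<le>degree p. smult ((-1) ^ k) ((pderiv ^^ k) p))"

lemma alternating_pderivs_add_pderiv:
  fixes p :: "'a::idom poly"
  shows "alternating_pderivs p + pderiv (alternating_pderivs p) = p"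
proof -
  \<comment> \<open>The bound \<open>N\<close> is decoupled from \<open>degree p\<close> so that
    induction applies. Neighbouring terms cancel, leaving a remainder that vanishes at
    \<open>N = degree p\<close>.\<close>
  have telescope: "(\<Sum>k\<le>N. smult ((-1) ^ k) ((pderiv ^^ k) p))
      + pderiv (\<Sum>k\<le>N. smult ((-1) ^ k) ((pderiv ^^ k) p))
      = p + smult ((-1) ^ N) ((pderiv ^^ Suc N) p)" for N
    by (induction N) (simp_all add: pderiv_add pderiv_diff pderiv_smult algebra_simps)
  have "(pderiv ^^ Suc (degree p)) p = 0"
    by (rule poly_eqI) (simp only: coeff_higher_pderiv, simp add: coeff_eq_0)
  then show ?thesis
    unfolding alternating_pderivs_def telescope by (simp del: funpow.simps)
qed

lemma poly_alternating_pderivs_div_fact_in_Ints: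
  fixes s :: "'a::field_char_0 poly"
  assumes "\<And>i. coeff s i \<in> \<int>" and "a \<in> \<int>"
  shows "poly (alternating_pderivs ([:-a, 1:] ^ n * s)) a / fact n \<in> \<int>"
proof -
  have "(-1) ^ k * (poly ((pderiv ^^ k) ([:-a, 1:] ^ n * s)) a / fact n) \<in> \<int>" for k
    by (intro Ints_mult Ints_power poly_higher_pderiv_div_fact_in_Ints assms) simp_all
  then show ?thesis
    unfolding alternating_pderivs_def poly_sum sum_divide_distrib by (intro Ints_sum) simp
qed

text \<open>Since F + F' = p, the function exp * F is an antiderivative of exp * p; the mean value
  theorem replaces an integral of exp * p.\<close>

lemma exp_alternating_pderivs_MVT:
  fixes a b :: real
  assumes "a < b"
  obtains t where "a < t" "t < b"
    "exp b * poly (alternating_pderivs p) b - exp a * poly (alternating_pderivs p) a =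
      (b - a) * (exp t * poly p t)"
proof -
  let ?F = "alternating_pderivs p"
  have "poly ?F x + poly (pderiv ?F) x = poly p x" for x
    by (metis alternating_pderivs_add_pderiv poly_add)
  then have "((\<lambda>x. exp x * poly ?F x) has_real_derivative exp x * poly p x) (at x)" for x
    by (auto intro!: derivative_eq_intros simp flip: distrib_left)
       (metis add.commute distrib_right mult.commute)
  with MVT2[OF assms, of "\<lambda>x. exp x * poly ?F x" "\<lambda>x. exp x * poly p x"] show ?thesis
    using that by blast
qed

lemma coeff_linear_power_in_Ints:
  fixes a :: "'a::comm_ring_1"
  assumes "a \<in> \<int>"
  shows "coeff ([:-a, 1:] ^ n) i \<in> \<int>"
proof (induction n arbitrary: i)
  case 0
  then show ?case by (simp add: coeff_1)
next
  case (Suc n)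
  then show ?case
    using assms by (auto simp: coeff_pCons split: nat.split)
qed

theorem theorem1:
  fixes r :: nat
  assumes "r > 0"
  shows "exp (real r) \<notin> \<rat>"
proof
  assume "exp (real r) \<in> \<rat>"
  then obtain p q :: int where q: "q > 0" and pq: "exp (real r) = of_int p / of_int q"
    by (auto elim: Rats_cases')
  \<comment> \<open>The terms of the convergent series for exp(r^2) tend to 0; the sequence is the
    later bound on \<open>\<bar>x\<bar>\<close>.\<close>
  have "(\<lambda>n. of_int q * real r * exp (real r) * ((real r * real r) ^ n / fact n)) \<longlonglongrightarrow>
      of_int q * real r * exp (real r) * 0"
    using summable_LIMSEQ_zero[OF summable_exp[of "real r * real r"]]
    by (intro tendsto_mult tendsto_const) (simp add: field_simps)
  then obtain n where
    small: "of_int q * real r * exp (real r) * ((real r * real r) ^ n / fact n) < 1"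
    using order_tendstoD(2)[of _ 0 sequentially 1] by (force simp: eventually_sequentially)
  \<comment> \<open>The factor X is written \<open>[:-0, 1:]\<close> to fit the integrality lemma at
    a = 0.\<close>
  define P :: "real poly" where "P = [:-0, 1:] ^ n * [:-real r, 1:] ^ n"
  define F where "F = alternating_pderivs P"
  have F0: "poly F 0 / fact n \<in> \<int>"
    unfolding F_def P_def
    by (intro poly_alternating_pderivs_div_fact_in_Ints coeff_linear_power_in_Ints) auto
  have Fr: "poly F (real r) / fact n \<in> \<int>"
    \<comment> \<open>Swapping the factors puts (X - r)^n in front, for the same lemma at a =
      r.\<close>
    unfolding F_def P_def mult.commute[of "[:-0, 1:] ^ n"]
    by (intro poly_alternating_pderivs_div_fact_in_Ints coeff_linear_power_in_Ints) auto
  obtain t where t: "0 < t" "t < real r"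
    and mvt: "exp (real r) * poly F (real r) - exp 0 * poly F 0 = real r * (exp t * poly P t)"
    using exp_alternating_pderivs_MVT[of 0 "real r" P] assms unfolding F_def by auto
  define x where "x = of_int q * (real r * (exp t * poly P t)) / fact n"
  \<comment> \<open>The denominator clears because q e^r = p.\<close>
  have "x = of_int p * (poly F (real r) / fact n) - of_int q * (poly F 0 / fact n)"
    unfolding x_def mvt[symmetric] pq using q by (simp add: field_simps)
  then have "x \<in> \<int>"
    using F0 Fr by (simp only: Ints_diff Ints_mult Ints_of_int)
  have Pt: "poly P t = (t * (t - real r)) ^ n"
    by (simp add: P_def power_mult_distrib)
  \<comment> \<open>As t lies strictly between the roots 0 and r, P(t) is nonzero.\<close>
  then have "x \<noteq> 0"
    unfolding x_def using t q assms by simp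
  then have "1 \<le> \<bar>x\<bar>"
    using \<open>x \<in> \<int>\<close> by (simp add: Ints_nonzero_abs_ge1)
  \<comment> \<open>Both |t| and |t - r| are at most r.\<close>
  have "\<bar>poly P t\<bar> \<le> (real r * real r) ^ n"
    unfolding Pt power_abs abs_mult using t by (intro power_mono mult_mono) auto
  then have "exp t * \<bar>poly P t\<bar> \<le> exp (real r) * (real r * real r) ^ n"
    using t by (intro mult_mono) auto
  then have "of_int q * real r * (exp t * \<bar>poly P t\<bar>) / fact n
      \<le> of_int q * real r * (exp (real r) * (real r * real r) ^ n) / fact n"
    using q by (intro divide_right_mono mult_left_mono) auto
  also have "\<dots> < 1"
    using small by (simp add: mult.assoc)
  finally have "\<bar>x\<bar> < 1"
    using q by (simp add: x_def abs_mult mult.assoc)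
  with \<open>1 \<le> \<bar>x\<bar>\<close> show False by simp
qed

end
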